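(* For any graphs $G$ and $H$ with $\mathcal V(G)=\{v_1,\dots,v_k\}$, $$\alpha^*(G|H)\ge \frac{|\mathcal V(G)|}{\alpha(G^c\boxtimes H)},$$ and equality holds if $G$ is vertex-transitive (i.e. then $W=G^c$ attains the supremum defining $\alpha^*(G|H)$). Moreover, for any graph $G$ on vertices $v_1,\dots,v_k$, $\alpha(G^c\boxtimes H)=\max\sum_{i=1}^k|\mathcal T_i|$, where the maximum is over all collections $\mathcal T_1,\dots,\mathcal T_k\in\mathcal I(H)$ such that $\mathcal T_i$ and $\mathcal T_j$ are disconnected in $H$ whenever $i\ne j$ and there is no edge between $v_i$ and $v_j$ in $G$.
   Context: All graphs are finite, simple, undirected. $\alpha$ is the independence number, $\boxtimes$ the strong product, $G^c$ the complement. $\alpha^*(G|H)=\sup_W \frac{\alpha(G\boxtimes W)}{\alpha(H\boxtimes W)}$ over all graphs $W$. $\mathcal I(H)$ is the set of independent sets of $H$ (including $\emptyset$); $\mathcal S,\mathcal T\in\mathcal I(H)$ are disconnected in $H$ if $\mathcal S\cap\mathcal T=\emptyset$ and $\mathcal S\cup\mathcal T\in\mathcal I(H)$. A graph is vertex-transitive if its automorphism group acts transitively on its vertices. *)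

theory Defs
  imports "Graph_Theory.Pair_Digraph" "HOL-Library.Extended_Real"
begin

text \<open>
  A finite simple undirected graph is a \<open>pair_graph\<close>: a finite, loop-free digraph without
  parallel arcs whose arc relation is symmetric. An edge between \<open>u\<close> and \<open>v\<close>
  is the pair of arcs \<open>(u, v)\<close>, \<open>(v, u)\<close>.
\<close>

definition indep_sets :: "'a pair_pre_digraph \<Rightarrow> 'a set set" where
  "indep_sets G = {S. S \<subseteq> pverts G \<and> (\<forall>u\<in>S. \<forall>v\<in>S. (u, v) \<notin> parcs G)}"

definition indep_num :: "'a pair_pre_digraph \<Rightarrow> nat" where
  "indep_num G = Max (card ` indep_sets G)"

definition compl_graph :: "'a pair_pre_digraph \<Rightarrow> 'a pair_pre_digraph" where
  "compl_graph G = \<lparr> pverts = pverts G,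
     parcs = {(u, v). u \<in> pverts G \<and> v \<in> pverts G \<and> u \<noteq> v \<and> (u, v) \<notin> parcs G} \<rparr>"

definition strong_prod ::
  "'a pair_pre_digraph \<Rightarrow> 'b pair_pre_digraph \<Rightarrow> ('a \<times> 'b) pair_pre_digraph" where
  "strong_prod G H = \<lparr> pverts = pverts G \<times> pverts H,
     parcs = {((u, x), (v, y)). u \<in> pverts G \<and> v \<in> pverts G \<and> x \<in> pverts H \<and> y \<in> pverts H \<and>
       (u, x) \<noteq> (v, y) \<and> (u = v \<or> (u, v) \<in> parcs G) \<and> (x = y \<or> (x, y) \<in> parcs H)} \<rparr>"

definition graph_automorphism :: "'a pair_pre_digraph \<Rightarrow> ('a \<Rightarrow> 'a) \<Rightarrow> bool" where
  "graph_automorphism G f \<longleftrightarrow> bij_betw f (pverts G) (pverts G) \<and>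
     (\<forall>u\<in>pverts G. \<forall>v\<in>pverts G. (f u, f v) \<in> parcs G \<longleftrightarrow> (u, v) \<in> parcs G)"

definition vertex_transitive :: "'a pair_pre_digraph \<Rightarrow> bool" where
  "vertex_transitive G \<longleftrightarrow>
     (\<forall>u\<in>pverts G. \<forall>v\<in>pverts G. \<exists>f. graph_automorphism G f \<and> f u = v)"

definition disconnected_in :: "'a pair_pre_digraph \<Rightarrow> 'a set \<Rightarrow> 'a set \<Rightarrow> bool" where
  "disconnected_in H S T \<longleftrightarrow> S \<inter> T = {} \<and> S \<union> T \<in> indep_sets H"

definition indep_ratio ::
  "'a pair_pre_digraph \<Rightarrow> 'b pair_pre_digraph \<Rightarrow> 'c pair_pre_digraph \<Rightarrow> real" where
  "indep_ratio G H W =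
     real (indep_num (strong_prod G W)) / real (indep_num (strong_prod H W))"

text \<open>
  The supremum is taken in the extended reals, so it needs no boundedness side condition. For
  nonempty \<open>H\<close>, nonemptiness of \<open>W\<close> says exactly that the denominator is
  nonzero. The vertices of \<open>W\<close> are natural numbers because a definition cannot quantify
  over types; every finite graph is isomorphic to one of these, and lemma
  \<open>indep_ratio_le_rel_indep\<close> below shows that the supremum bounds the ratio for
  \<open>W\<close> over any vertex type.
\<close>

definition rel_indep :: "'a pair_pre_digraph \<Rightarrow> 'b pair_pre_digraph \<Rightarrow> ereal" where
  "rel_indep G H =
     (SUP W\<in>{W :: nat pair_pre_digraph. pair_graph W \<and> pverts W \<noteq> {}}. ereal (indep_ratio G H W))"

lemma pair_graphI:
  assumes "finite (pverts G)"
    and "\<And>u v. (u, v) \<in> parcs G \<Longrightarrow> u \<in> pverts G \<and> v \<in> pverts G \<and> u \<noteq> v \<and> (v, u) \<in> parcs G"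
  shows "pair_graph G"
proof -
  have "parcs G \<subseteq> pverts G \<times> pverts G" using assms(2) by auto
  then have "finite (parcs G)" using assms(1) by (meson finite_SigmaI finite_subset)
  moreover have "fst e \<in> pverts G" "snd e \<in> pverts G" "fst e \<noteq> snd e" if "e \<in> parcs G" for e
    using assms(2)[of "fst e" "snd e"] that by auto
  moreover have "symmetric (with_proj G)"
    using assms(2) by (auto simp: symmetric_def intro!: symI)
  ultimately show ?thesis
    using assms(1) by unfold_locales simp_all
qed

lemma pair_graphD:
  assumes "pair_graph G"
  shows "finite (pverts G)"
    and "(u, v) \<in> parcs G \<Longrightarrow> u \<in> pverts G \<and> v \<in> pverts G \<and> u \<noteq> v \<and> (v, u) \<in> parcs G"
proof -
  interpret pair_graph G by (rule assms)
  show "finite (pverts G)" by (rule pair_finite_verts)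
  show "(u, v) \<in> parcs G \<Longrightarrow> u \<in> pverts G \<and> v \<in> pverts G \<and> u \<noteq> v \<and> (v, u) \<in> parcs G"
    using pair_no_loops[of "(u, v)"] pair_sym_arcs in_arcsD1[of u v] in_arcsD2[of u v]
    by (auto simp: symmetric_def dest: symD)
qed

lemma pair_graph_compl_graph: "pair_graph G \<Longrightarrow> pair_graph (compl_graph G)"
  by (rule pair_graphI) (auto simp: compl_graph_def dest: pair_graphD)

lemma pair_graph_strong_prod:
  "pair_graph G \<Longrightarrow> pair_graph H \<Longrightarrow> pair_graph (strong_prod G H)"
  by (rule pair_graphI) (auto simp: strong_prod_def dest: pair_graphD)

lemma finite_indep_sets: "pair_graph G \<Longrightarrow> finite (indep_sets G)"
  by (rule finite_subset[of _ "Pow (pverts G)"]) (auto simp: indep_sets_def dest: pair_graphD)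

lemma empty_in_indep_sets: "{} \<in> indep_sets G"
  by (simp add: indep_sets_def)

lemma indep_num_iso:
  assumes "bij_betw f (pverts G) (pverts G')"
    and "\<And>u v. u \<in> pverts G \<Longrightarrow> v \<in> pverts G \<Longrightarrow> (f u, f v) \<in> parcs G' \<longleftrightarrow> (u, v) \<in> parcs G"
  shows "indep_num G' = indep_num G"
proof -
  have inj: "inj_on f (pverts G)" and im: "f ` pverts G = pverts G'"
    using assms(1) by (auto simp: bij_betw_def)
  have "indep_sets G' = (`) f ` indep_sets G"
  proof (intro equalityI subsetI)
    fix S assume S: "S \<in> indep_sets G'"
    define R where "R = {u \<in> pverts G. f u \<in> S}"
    have "S = f ` R" using S im by (auto simp: R_def indep_sets_def)
    moreover have "R \<in> indep_sets G"
      using S assms(2) unfolding R_def indep_sets_def by blast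
    ultimately show "S \<in> (`) f ` indep_sets G" by blast
  next
    fix S assume "S \<in> (`) f ` indep_sets G"
    then obtain R where "R \<in> indep_sets G" "S = f ` R" by blast
    then show "S \<in> indep_sets G'"
      using im assms(2) unfolding indep_sets_def by blast
  qed
  moreover have "card (f ` R) = card R" if "R \<in> indep_sets G" for R
    using that inj by (auto simp: indep_sets_def intro!: card_image inj_on_subset[OF inj])
  ultimately show ?thesis by (simp add: indep_num_def image_image cong: image_cong)
qed

lemma indep_num_strong_prod_iso:
  assumes "bij_betw f (pverts W) (pverts W')"
    and "\<And>u v. u \<in> pverts W \<Longrightarrow> v \<in> pverts W \<Longrightarrow> (f u, f v) \<in> parcs W' \<longleftrightarrow> (u, v) \<in> parcs W"
  shows "indep_num (strong_prod G W') = indep_num (strong_prod G W)"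
proof (rule indep_num_iso[of "map_prod id f"])
  show "bij_betw (map_prod id f) (pverts (strong_prod G W)) (pverts (strong_prod G W'))"
    using bij_betw_map_prod[OF bij_betw_id assms(1)] by (simp add: strong_prod_def id_def)
  have mem: "f u \<in> pverts W'" if "u \<in> pverts W" for u
    using that assms(1) by (auto simp: bij_betw_def)
  have eq: "f u = f v \<longleftrightarrow> u = v" if "u \<in> pverts W" "v \<in> pverts W" for u v
    using that assms(1) by (auto simp: bij_betw_def inj_on_def)
  show "(map_prod id f p, map_prod id f q) \<in> parcs (strong_prod G W') \<longleftrightarrow>
      (p, q) \<in> parcs (strong_prod G W)"
    if "p \<in> pverts (strong_prod G W)" "q \<in> pverts (strong_prod G W)" for p q
    using that by (cases p; cases q) (simp add: strong_prod_def mem eq assms(2))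
qed

lemma indep_ratio_le_rel_indep:
  fixes W :: "'c pair_pre_digraph"
  assumes "pair_graph W" "pverts W \<noteq> {}"
  shows "ereal (indep_ratio G H W) \<le> rel_indep G H"
proof -
  obtain f :: "'c \<Rightarrow> nat" where f: "inj_on f (pverts W)"
    using finite_imp_inj_to_nat_seg[OF pair_graphD(1)[OF assms(1)]] by blast
  define W' where "W' = \<lparr> pverts = f ` pverts W, parcs = map_prod f f ` parcs W \<rparr>"
  have bij: "bij_betw f (pverts W) (pverts W')"
    using f by (simp add: W'_def bij_betw_def)
  have arcs: "(f u, f v) \<in> parcs W' \<longleftrightarrow> (u, v) \<in> parcs W"
    if "u \<in> pverts W" "v \<in> pverts W" for u v
  proof
    assume "(f u, f v) \<in> parcs W'"
    then obtain a b where ab: "(a, b) \<in> parcs W" "f u = f a" "f v = f b"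
      by (auto simp: W'_def)
    then show "(u, v) \<in> parcs W"
      using that f pair_graphD(2)[OF assms(1) ab(1)] by (metis inj_onD)
  qed (force simp: W'_def)
  have "pair_graph W'"
  proof (rule pair_graphI)
    show "finite (pverts W')" using pair_graphD(1)[OF assms(1)] by (simp add: W'_def)
    fix x y assume "(x, y) \<in> parcs W'"
    then obtain a b where ab: "(a, b) \<in> parcs W" "x = f a" "y = f b"
      by (auto simp: W'_def)
    note ab' = pair_graphD(2)[OF assms(1) ab(1)]
    then have "f a \<noteq> f b" using f by (auto dest: inj_onD)
    moreover have "(f b, f a) \<in> parcs W'" using ab' arcs by blast
    ultimately show "x \<in> pverts W' \<and> y \<in> pverts W' \<and> x \<noteq> y \<and> (y, x) \<in> parcs W'"
      using ab ab' by (simp add: W'_def)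
  qed
  moreover have "pverts W' \<noteq> {}" using assms(2) by (simp add: W'_def)
  moreover have "indep_ratio G H W = indep_ratio G H W'"
    using indep_num_strong_prod_iso[OF bij arcs, of G] indep_num_strong_prod_iso[OF bij arcs, of H]
    by (simp add: indep_ratio_def)
  ultimately show ?thesis
    unfolding rel_indep_def by (auto intro: SUP_upper)
qed

end

theory Submission
  imports Defs
begin

text \<open>
  The diagonal is independent in \<open>G \<boxtimes> G\<^sup>c\<close>, so \<open>W = G\<^sup>c\<close> gives the lower bound. For the
  matching upper bound, take independent sets \<open>A\<close> of \<open>G \<boxtimes> W\<close> and \<open>B\<close> of
  \<open>G\<^sup>c \<boxtimes> H\<close> and twist \<open>B\<close> by an automorphism \<open>f\<close> of \<open>G\<close>: the pairs
  \<open>(h, w)\<close> with \<open>(g, w) \<in> A\<close> and \<open>(f g, h) \<in> B\<close> for some \<open>g\<close> form an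
  independent set of \<open>H \<boxtimes> W\<close>, and \<open>g\<close> is determined by \<open>(h, w)\<close>. When \<open>G\<close> is
  vertex-transitive, averaging the size of this set over all \<open>f\<close> gives
  \<open>|A| |B| / |V(G)| \<le> \<alpha>(H \<boxtimes> W)\<close>.
\<close>

section \<open>Independent sets in strong products\<close>

lemma card_le_indep_num: "pair_graph G \<Longrightarrow> S \<in> indep_sets G \<Longrightarrow> card S \<le> indep_num G"
  unfolding indep_num_def by (rule Max_ge) (auto simp: finite_indep_sets)

lemma indep_num_attained:
  assumes "pair_graph G"
  obtains S where "S \<in> indep_sets G" "card S = indep_num G"
proof -
  have "indep_num G \<in> card ` indep_sets G"
    unfolding indep_num_def
    by (rule Max_in) (use assms finite_indep_sets empty_in_indep_sets in auto)
  then show thesis using that by auto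
qed

lemma indep_num_pos:
  assumes "pair_graph G" "pverts G \<noteq> {}"
  shows "indep_num G > 0"
proof -
  obtain u where u: "u \<in> pverts G" using assms(2) by blast
  have "{u} \<in> indep_sets G"
    using u pair_graphD(2)[OF assms(1), of u u] by (auto simp: indep_sets_def)
  from card_le_indep_num[OF assms(1) this] show ?thesis by simp
qed

lemma indep_sets_subset: "S \<in> indep_sets G \<Longrightarrow> S \<subseteq> pverts G"
  by (simp add: indep_sets_def)

lemma pverts_compl_graph [simp]: "pverts (compl_graph G) = pverts G"
  by (simp add: compl_graph_def)

lemma pverts_strong_prod [simp]: "pverts (strong_prod G H) = pverts G \<times> pverts H"
  by (simp add: strong_prod_def)

text \<open>Coordinatewise form of independence: members that are equal or adjacent in both
  coordinates must coincide. Together with the elimination rule below, it spares later arguments the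
  arc set of the product.\<close>

lemma indep_sets_strong_prodI:
  assumes "S \<subseteq> pverts G \<times> pverts H"
    and "\<And>u x v y. (u, x) \<in> S \<Longrightarrow> (v, y) \<in> S \<Longrightarrow> u = v \<or> (u, v) \<in> parcs G \<Longrightarrow>
      x = y \<or> (x, y) \<in> parcs H \<Longrightarrow> u = v \<and> x = y"
  shows "S \<in> indep_sets (strong_prod G H)"
proof -
  have "(p, q) \<notin> parcs (strong_prod G H)" if "p \<in> S" "q \<in> S" for p q
  proof (cases p, cases q)
    fix u x v y assume pq: "p = (u, x)" "q = (v, y)"
    show ?thesis
      using assms(2)[OF that[unfolded pq]]
      unfolding pq strong_prod_def pair_pre_digraph.simps by blast
  qed
  with assms(1) show ?thesis by (simp add: indep_sets_def)
qed

lemma indep_sets_strong_prodD: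
  assumes S: "S \<in> indep_sets (strong_prod G H)" "(u, x) \<in> S" "(v, y) \<in> S"
    and uv: "u = v \<or> (u, v) \<in> parcs G" and xy: "x = y \<or> (x, y) \<in> parcs H"
  shows "u = v \<and> x = y"
proof -
  have "((u, x), (v, y)) \<notin> parcs (strong_prod G H)" using S by (auto simp: indep_sets_def)
  moreover have "(u, x) \<in> pverts G \<times> pverts H" "(v, y) \<in> pverts G \<times> pverts H"
    using indep_sets_subset[OF S(1)] S(2,3) by auto
  ultimately show ?thesis using uv xy by (simp add: strong_prod_def)
qed

lemma indep_num_strong_prod_commute:
  "indep_num (strong_prod G H) = indep_num (strong_prod H G)"
  by (rule indep_num_iso[of prod.swap]) (auto simp: strong_prod_def bij_betw_def)

text \<open>The diagonal works because no two vertices are adjacent both in \<open>G\<close> and in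
  its complement.\<close>

lemma card_le_indep_num_strong_prod_compl:
  assumes "pair_graph G"
  shows "card (pverts G) \<le> indep_num (strong_prod G (compl_graph G))"
proof -
  let ?D = "(\<lambda>u. (u, u)) ` pverts G"
  have "?D \<in> indep_sets (strong_prod G (compl_graph G))"
    by (rule indep_sets_strong_prodI) (auto simp: compl_graph_def)
  moreover have "card ?D = card (pverts G)" by (rule card_image) (simp add: inj_on_def)
  ultimately show ?thesis
    using card_le_indep_num[OF pair_graph_strong_prod[OF assms pair_graph_compl_graph[OF assms]]]
    by metis
qed

section \<open>Fibres and the set twisted by an automorphism\<close>

lemma card_conv_sum_fibres:
  assumes "A \<subseteq> U \<times> V" "finite U" "finite V"
  shows "card A = (\<Sum>u\<in>U. card {x. (u, x) \<in> A})"
proof -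
  have "A = (SIGMA u:U. {x. (u, x) \<in> A})" using assms(1) by auto
  moreover have "finite {x. (u, x) \<in> A}" for u
    by (rule finite_subset[OF _ assms(3)]) (use assms(1) in auto)
  ultimately show ?thesis using card_SigmaI[OF assms(2)] by metis
qed

text \<open>The left side counts the triples (g, h, w) with (g, w) in \<open>A\<close> and (f g, h)
  in \<open>B\<close>; forgetting g is injective on them and leaves an independent set.\<close>

lemma sum_fibres_le_indep_num:
  assumes G: "pair_graph G" and H: "pair_graph H" and W: "pair_graph W"
    and f: "graph_automorphism G f"
    and A: "A \<in> indep_sets (strong_prod G W)"
    and B: "B \<in> indep_sets (strong_prod (compl_graph G) H)"
  shows "(\<Sum>g\<in>pverts G. card {w. (g, w) \<in> A} * card {h. (f g, h) \<in> B})
           \<le> indep_num (strong_prod H W)"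
proof -
  have Asub: "A \<subseteq> pverts G \<times> pverts W" and Bsub: "B \<subseteq> pverts G \<times> pverts H"
    using indep_sets_subset[OF A] indep_sets_subset[OF B] by simp_all
  let ?T = "SIGMA g:pverts G. {h. (f g, h) \<in> B} \<times> {w. (g, w) \<in> A}"
  have fin: "finite {w. (g, w) \<in> A}" "finite {h. (g, h) \<in> B}" for g
    by (rule finite_subset[OF _ pair_graphD(1)[OF W]], use Asub in auto)
      (rule finite_subset[OF _ pair_graphD(1)[OF H]], use Bsub in auto)
  \<comment> \<open>This serves twice: with h = h' and w = w' it makes \<open>snd\<close> injective
    on \<open>?T\<close>, and in general it makes the image independent.\<close>
  have key: "g = g' \<and> h = h' \<and> w = w'"
    if gw: "(g, w) \<in> A" "(g', w') \<in> A" and gh: "(f g, h) \<in> B" "(f g', h') \<in> B"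
      and h: "h = h' \<or> (h, h') \<in> parcs H" and w: "w = w' \<or> (w, w') \<in> parcs W"
    for g g' h h' w w'
  \<comment> \<open>If g and g' are equal or adjacent, \<open>A\<close> forces equality. Otherwise
    \<open>f\<close> preserves their non-adjacency, and \<open>B\<close> forces f g = f g', which is
    impossible.\<close>
  proof (cases "g = g' \<or> (g, g') \<in> parcs G")
    case True
    from indep_sets_strong_prodD[OF A gw True w] have "g = g'" "w = w'" by auto
    moreover from this indep_sets_strong_prodD[OF B gh _ h] have "h = h'" by auto
    ultimately show ?thesis by simp
  next
    case False
    have V: "g \<in> pverts G" "g' \<in> pverts G" using gw Asub by auto
    then have "(f g, f g') \<in> parcs (compl_graph G)"
      using False f by (auto simp: graph_automorphism_def compl_graph_def bij_betw_def dest: inj_onD)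
    with indep_sets_strong_prodD[OF B gh _ h] have "f g = f g'" by blast
    with V f have "g = g'" by (auto simp: graph_automorphism_def bij_betw_def dest: inj_onD)
    with False show ?thesis by simp
  qed
  have inj: "inj_on snd ?T" unfolding inj_on_def using key by fastforce
  have "snd ` ?T \<in> indep_sets (strong_prod H W)"
  proof (rule indep_sets_strong_prodI)
    show "snd ` ?T \<subseteq> pverts H \<times> pverts W" using Asub Bsub by auto
    fix h w h' w'
    assume "(h, w) \<in> snd ` ?T" "(h', w') \<in> snd ` ?T"
      and adj: "h = h' \<or> (h, h') \<in> parcs H" "w = w' \<or> (w, w') \<in> parcs W"
    then obtain g g' where "(g, w) \<in> A" "(g', w') \<in> A" "(f g, h) \<in> B" "(f g', h') \<in> B"
      by auto
    from key[OF this adj] show "h = h' \<and> w = w'" by simp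
  qed
  from card_le_indep_num[OF pair_graph_strong_prod[OF H W] this]
  have "card ?T \<le> indep_num (strong_prod H W)" by (simp add: card_image[OF inj])
  then show ?thesis
    using fin pair_graphD(1)[OF G]
    by (simp add: card_SigmaI card_cartesian_product mult.commute)
qed

section \<open>Averaging over the automorphisms\<close>

text \<open>Restricting automorphisms to the vertex set makes their number finite.\<close>

definition automorphisms :: "'a pair_pre_digraph \<Rightarrow> ('a \<Rightarrow> 'a) set" where
  "automorphisms G = {f \<in> extensional (pverts G). graph_automorphism G f}"

lemma finite_automorphisms:
  assumes "finite (pverts G)"
  shows "finite (automorphisms G)"
  by (rule finite_subset[OF _ finite_PiE[OF assms, of "\<lambda>_. pverts G"]])
    (auto simp: automorphisms_def graph_automorphism_def PiE_def bij_betw_def assms)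

lemma automorphisms_nonempty: "automorphisms G \<noteq> {}"
proof -
  have "restrict id (pverts G) \<in> automorphisms G"
    by (auto simp: automorphisms_def graph_automorphism_def bij_betw_def)
  then show ?thesis by blast
qed

lemma graph_automorphism_restrict_comp:
  assumes "graph_automorphism G s" "graph_automorphism G f"
  shows "restrict (s \<circ> f) (pverts G) \<in> automorphisms G"
proof -
  have "bij_betw (s \<circ> f) (pverts G) (pverts G)"
    using assms by (auto simp: graph_automorphism_def intro: bij_betw_trans)
  then have "bij_betw (restrict (s \<circ> f) (pverts G)) (pverts G) (pverts G)"
    by (simp cong: bij_betw_cong)
  moreover have "f u \<in> pverts G" if "u \<in> pverts G" for u
    using assms(2) that by (auto simp: graph_automorphism_def bij_betw_def)
  ultimately show ?thesis
    using assms by (simp add: automorphisms_def graph_automorphism_def)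
qed

text \<open>Composing with an automorphism that takes \<open>u\<close> to \<open>u'\<close> is
  injective. Exchanging \<open>u\<close> and \<open>u'\<close> then shows that all these sets have
  the same size.\<close>

lemma card_automorphisms_mapping_le:
  assumes "pair_graph G" "vertex_transitive G"
    and "g \<in> pverts G" "u \<in> pverts G" "u' \<in> pverts G"
  shows "card {f \<in> automorphisms G. f g = u} \<le> card {f \<in> automorphisms G. f g = u'}"
proof -
  obtain s where s: "graph_automorphism G s" "s u = u'"
    using assms(2,4,5) by (auto simp: vertex_transitive_def)
  let ?c = "\<lambda>f. restrict (s \<circ> f) (pverts G)"
  show ?thesis
  proof (rule card_inj_on_le[of ?c])
    show "inj_on ?c {f \<in> automorphisms G. f g = u}"
    proof (rule inj_onI)
      fix f f' assume f: "f \<in> {f \<in> automorphisms G. f g = u}" "f' \<in> {f \<in> automorphisms G. f g = u}"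
        and eq: "?c f = ?c f'"
      show "f = f'"
      proof (rule extensionalityI[of _ "pverts G"])
        show "f \<in> extensional (pverts G)" "f' \<in> extensional (pverts G)"
          using f by (auto simp: automorphisms_def)
        fix x assume x: "x \<in> pverts G"
        then have "s (f x) = s (f' x)" using fun_cong[OF eq, of x] by simp
        moreover have "f x \<in> pverts G" "f' x \<in> pverts G"
          using f x by (auto simp: automorphisms_def graph_automorphism_def bij_betw_def)
        ultimately show "f x = f' x"
          using s(1) by (auto simp: graph_automorphism_def bij_betw_def dest: inj_onD)
      qed
    qed
    show "?c ` {f \<in> automorphisms G. f g = u} \<subseteq> {f \<in> automorphisms G. f g = u'}"
      using graph_automorphism_restrict_comp[OF s(1)] s(2) assms(3)
      by (auto simp: automorphisms_def)
    show "finite {f \<in> automorphisms G. f g = u'}"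
      using finite_automorphisms[OF pair_graphD(1)[OF assms(1)]] by simp
  qed
qed

text \<open>As \<open>f\<close> runs over the automorphisms, f g hits every vertex equally often, so
  the average of b (f g) is the average of \<open>b\<close>. Multiplying out keeps the identity in
  the natural numbers.\<close>

lemma sum_automorphisms_orbit:
  fixes b :: "'a \<Rightarrow> nat"
  assumes G: "pair_graph G" and vt: "vertex_transitive G" and g: "g \<in> pverts G"
  shows "card (pverts G) * (\<Sum>f\<in>automorphisms G. b (f g))
           = card (automorphisms G) * (\<Sum>u\<in>pverts G. b u)"
proof -
  have fin: "finite (pverts G)" "finite (automorphisms G)"
    using pair_graphD(1)[OF G] finite_automorphisms by auto
  have im: "(\<lambda>f. f g) ` automorphisms G \<subseteq> pverts G"
    using g by (auto simp: automorphisms_def graph_automorphism_def bij_betw_def)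
  \<comment> \<open>The target g is an arbitrary choice; any vertex gives the same number.\<close>
  define N where "N = card {f \<in> automorphisms G. f g = g}"
  have N: "card {f \<in> automorphisms G. f g = u} = N" if "u \<in> pverts G" for u
    unfolding N_def by (intro antisym card_automorphisms_mapping_le[OF G vt g] that g)
  have avg: "(\<Sum>f\<in>automorphisms G. c (f g)) = N * (\<Sum>u\<in>pverts G. c u)" for c :: "'a \<Rightarrow> nat"
  proof -
    have "(\<Sum>f\<in>automorphisms G. c (f g))
        = (\<Sum>u\<in>pverts G. \<Sum>f | f \<in> automorphisms G \<and> f g = u. c (f g))"
      using sum.group[OF fin(2) fin(1) im, of "\<lambda>f. c (f g)"] by simp
    also have "\<dots> = (\<Sum>u\<in>pverts G. N * c u)"
      by (rule sum.cong) (simp_all add: N)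
    finally show ?thesis by (simp add: sum_distrib_left)
  qed
  \<comment> \<open>The constant function 1 determines \<open>N\<close>, which can then be
    eliminated.\<close>
  from avg[of "\<lambda>_. 1"] have "card (automorphisms G) = N * card (pverts G)" by simp
  then show ?thesis by (simp add: avg)
qed

lemma indep_num_strong_prod_mult_le:
  assumes G: "pair_graph G" and H: "pair_graph H" and W: "pair_graph W"
    and vt: "vertex_transitive G"
  shows "indep_num (strong_prod G W) * indep_num (strong_prod (compl_graph G) H)
           \<le> card (pverts G) * indep_num (strong_prod H W)"
proof -
  obtain A where A: "A \<in> indep_sets (strong_prod G W)" "card A = indep_num (strong_prod G W)"
    using indep_num_attained[OF pair_graph_strong_prod[OF G W]] .
  obtain B where B: "B \<in> indep_sets (strong_prod (compl_graph G) H)"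
      "card B = indep_num (strong_prod (compl_graph G) H)"
    using indep_num_attained[OF pair_graph_strong_prod[OF pair_graph_compl_graph[OF G] H]] .
  define a where "a g = card {w. (g, w) \<in> A}" for g
  define b where "b g = card {h. (g, h) \<in> B}" for g
  let ?V = "pverts G" and ?F = "automorphisms G" and ?M = "indep_num (strong_prod H W)"
  have cA: "card A = (\<Sum>g\<in>?V. a g)" unfolding a_def
    by (rule card_conv_sum_fibres[of _ _ "pverts W"])
      (use indep_sets_subset[OF A(1)] pair_graphD(1) G W in auto)
  have cB: "card B = (\<Sum>g\<in>?V. b g)" unfolding b_def
    by (rule card_conv_sum_fibres[of _ _ "pverts H"])
      (use indep_sets_subset[OF B(1)] pair_graphD(1) G H in auto)
  \<comment> \<open>The factor \<open>card ?F\<close> lets |B| be replaced, separately for each g,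
    by a sum of b (f g) over all \<open>f\<close>.\<close>
  have "card ?F * (card A * card B) = (\<Sum>g\<in>?V. a g * (card ?F * (\<Sum>u\<in>?V. b u)))"
    by (simp add: cA cB sum_distrib_right[symmetric])
  also have "\<dots> = (\<Sum>g\<in>?V. a g * (card ?V * (\<Sum>f\<in>?F. b (f g))))"
    by (simp add: sum_automorphisms_orbit[OF G vt])
  also have "\<dots> = card ?V * (\<Sum>g\<in>?V. \<Sum>f\<in>?F. a g * b (f g))"
    by (simp add: sum_distrib_left mult.left_commute)
  \<comment> \<open>With \<open>f\<close> outermost, each inner sum is the size of one twisted
    set.\<close>
  also have "\<dots> = card ?V * (\<Sum>f\<in>?F. \<Sum>g\<in>?V. a g * b (f g))"
    by (subst sum.swap) simp
  also have "\<dots> \<le> card ?V * (\<Sum>f\<in>?F. ?M)"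
    using sum_fibres_le_indep_num[OF G H W _ A(1) B(1)]
    by (intro mult_left_mono sum_mono) (simp_all add: automorphisms_def a_def b_def)
  finally have "card ?F * (card A * card B) \<le> card ?F * (card ?V * ?M)"
    by (simp add: mult.left_commute)
  moreover have "card ?F > 0"
    using finite_automorphisms[OF pair_graphD(1)[OF G]] automorphisms_nonempty[of G]
    by (simp add: card_gt_0_iff)
  ultimately show ?thesis using A(2) B(2) by simp
qed

section \<open>The maximum over families of independent sets\<close>

text \<open>An independent set of the product and its fibres \<open>T i\<close> over
  \<open>v i\<close> determine each other. Distinct vertices non-adjacent in \<open>G\<close> are
  adjacent in the complement, so independence across their fibres is exactly
  disconnectedness.\<close>

lemma card_indep_sets_strong_prod_compl:
  fixes v :: "nat \<Rightarrow> 'a" and H :: "'b pair_pre_digraph"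
  assumes G: "pair_graph G" and H: "pair_graph H" and v: "bij_betw v {1..k} (pverts G)"
  shows "card ` indep_sets (strong_prod (compl_graph G) H) =
           {(\<Sum>i=1..k. card (T i)) | T :: nat \<Rightarrow> 'b set.
             (\<forall>i\<in>{1..k}. T i \<in> indep_sets H) \<and>
             (\<forall>i\<in>{1..k}. \<forall>j\<in>{1..k}. i \<noteq> j \<and> (v i, v j) \<notin> parcs G \<longrightarrow>
                disconnected_in H (T i) (T j))}" (is "_ = {_ | T. ?P T}")
proof -
  have inj: "v i = v j \<longleftrightarrow> i = j" if "i \<in> {1..k}" "j \<in> {1..k}" for i j
    using inj_on_eq_iff[OF bij_betw_imp_inj_on[OF v] that] .
  have vV: "v i \<in> pverts G" if "i \<in> {1..k}" for i
    using bij_betw_apply[OF v that] .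
  have card: "card B = (\<Sum>i=1..k. card {x. (v i, x) \<in> B})" if "B \<subseteq> pverts G \<times> pverts H" for B
  proof -
    have "card B = (\<Sum>u\<in>pverts G. card {x. (u, x) \<in> B})"
      by (rule card_conv_sum_fibres[OF that]) (use G H pair_graphD(1) in auto)
    also have "\<dots> = (\<Sum>i=1..k. card {x. (v i, x) \<in> B})"
      by (rule sum.reindex_bij_betw[OF v, symmetric])
    finally show ?thesis .
  qed
  show ?thesis
  proof (intro equalityI subsetI)
    fix n assume "n \<in> card ` indep_sets (strong_prod (compl_graph G) H)"
    then obtain B where B: "B \<in> indep_sets (strong_prod (compl_graph G) H)" and n: "n = card B"
      by blast
    then have sub: "B \<subseteq> pverts G \<times> pverts H"
      using indep_sets_subset[OF B] by simp
    define T where "T i = {x. (v i, x) \<in> B}" for i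
    have TH: "T i \<subseteq> pverts H" for i using sub by (auto simp: T_def)
    have loop: "(x, x) \<notin> parcs H" for x using pair_graphD(2)[OF H, of x x] by blast
    have ind: "(x, y) \<notin> parcs H" "i \<noteq> j \<longrightarrow> x \<noteq> y"
      if "i \<in> {1..k}" "j \<in> {1..k}" "x \<in> T i" "y \<in> T j" "i = j \<or> (v i, v j) \<notin> parcs G" for i j x y
    proof -
      have *: "v i = v j \<or> (v i, v j) \<in> parcs (compl_graph G)"
        using that(5) vV[OF that(1)] vV[OF that(2)] by (auto simp: compl_graph_def)
      note D = indep_sets_strong_prodD[OF B that(3,4)[unfolded T_def mem_Collect_eq] *]
      show "(x, y) \<notin> parcs H" using D loop by blast
      show "i \<noteq> j \<longrightarrow> x \<noteq> y" using D inj[OF that(1,2)] by blast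
    qed
    have "?P T"
    proof (intro conjI ballI impI)
      show "T i \<in> indep_sets H" if "i \<in> {1..k}" for i
        using TH ind(1)[OF that that] by (auto simp: indep_sets_def)
      fix i j assume ij: "i \<in> {1..k}" "j \<in> {1..k}" and ne: "i \<noteq> j \<and> (v i, v j) \<notin> parcs G"
      then have ne': "(v j, v i) \<notin> parcs G" using pair_graphD(2)[OF G] by blast
      show "disconnected_in H (T i) (T j)"
        unfolding disconnected_in_def indep_sets_def
        \<comment> \<open>Independence of the union excludes arcs within each fibre and in both
          directions between them, hence the four instances of \<open>ind\<close>.\<close>
        using TH ne ne' ind[OF ij] ind(1)[OF ij(2,1)] ind(1)[OF ij(1,1)] ind(1)[OF ij(2,2)]
        by (simp, blast)
    qed
    moreover have "n = (\<Sum>i=1..k. card (T i))" using card[OF sub] n by (simp add: T_def)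
    ultimately show "n \<in> {(\<Sum>i=1..k. card (T i)) | T. ?P T}" by blast
  next
    fix n assume "n \<in> {(\<Sum>i=1..k. card (T i)) | T. ?P T}"
    then obtain T where n: "n = (\<Sum>i=1..k. card (T i))" and T: "?P T" by blast
    define B where "B = (\<Union>i\<in>{1..k}. {v i} \<times> T i)"
    have fibre: "{x. (v i, x) \<in> B} = T i" if "i \<in> {1..k}" for i
      using inj that by (auto simp: B_def)
    have sub: "B \<subseteq> pverts G \<times> pverts H"
      using T vV by (fastforce simp: B_def indep_sets_def)
    have "B \<in> indep_sets (strong_prod (compl_graph G) H)"
    proof (rule indep_sets_strong_prodI)
      show "B \<subseteq> pverts (compl_graph G) \<times> pverts H" using sub by simp
      fix g x g' y
      assume *: "(g, x) \<in> B" "(g', y) \<in> B" "g = g' \<or> (g, g') \<in> parcs (compl_graph G)"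
        "x = y \<or> (x, y) \<in> parcs H"
      then obtain i j where ij: "i \<in> {1..k}" "j \<in> {1..k}" "g = v i" "g' = v j" "x \<in> T i" "y \<in> T j"
        by (auto simp: B_def)
      \<comment> \<open>For i \<noteq> j the vertices would be non-adjacent in \<open>G\<close>, so
        \<open>T i\<close> and \<open>T j\<close> would be disconnected, yet x and y are equal or
        adjacent.\<close>
      have "i = j"
      proof (rule ccontr)
        assume "i \<noteq> j"
        moreover from this have "(v i, v j) \<notin> parcs G"
          using * ij inj by (auto simp: compl_graph_def)
        ultimately have "disconnected_in H (T i) (T j)" using T ij by blast
        then show False using * ij by (auto simp: disconnected_in_def indep_sets_def)
      qed
      moreover from this have "(x, y) \<notin> parcs H" using T ij by (auto simp: indep_sets_def)
      ultimately show "g = g' \<and> x = y" using * ij by auto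
    qed
    moreover have "n = card B" using card[OF sub] fibre n by simp
    ultimately show "n \<in> card ` indep_sets (strong_prod (compl_graph G) H)" by blast
  qed
qed

theorem theorem5:
  fixes G :: "'a pair_pre_digraph" and H :: "'b pair_pre_digraph"
    and v :: "nat \<Rightarrow> 'a" and k :: nat
  assumes "pair_graph G" and "pair_graph H"
    and "bij_betw v {1..k} (pverts G)"
  shows "(pverts G \<noteq> {} \<and> pverts H \<noteq> {} \<longrightarrow>
           rel_indep G H \<ge>
             ereal (real (card (pverts G)) / real (indep_num (strong_prod (compl_graph G) H))) \<and>
           (vertex_transitive G \<longrightarrow>
             rel_indep G H =
               ereal (real (card (pverts G)) / real (indep_num (strong_prod (compl_graph G) H))) \<and>
             rel_indep G H = ereal (indep_ratio G H (compl_graph G)))) \<and>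
         indep_num (strong_prod (compl_graph G) H) =
           Max {(\<Sum>i=1..k. card (T i)) | T :: nat \<Rightarrow> 'b set.
             (\<forall>i\<in>{1..k}. T i \<in> indep_sets H) \<and>
             (\<forall>i\<in>{1..k}. \<forall>j\<in>{1..k}. i \<noteq> j \<and> (v i, v j) \<notin> parcs G \<longrightarrow>
                disconnected_in H (T i) (T j))}"
proof (intro conjI impI)
  let ?r = "real (card (pverts G)) / real (indep_num (strong_prod (compl_graph G) H))"
  assume "pverts G \<noteq> {} \<and> pverts H \<noteq> {}"
  then have ne: "pverts G \<noteq> {}" "pverts H \<noteq> {}" by auto
  note G = assms(1) and H = assms(2)
  have Gc: "pair_graph (compl_graph G)" "pverts (compl_graph G) \<noteq> {}"
    using pair_graph_compl_graph[OF G] ne by auto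
  \<comment> \<open>Positive denominators matter because x / 0 = 0 in HOL, which would break the
    cross-multiplication below.\<close>
  have pos': "indep_num (strong_prod (compl_graph G) H) > 0"
    using indep_num_pos[OF pair_graph_strong_prod[OF Gc(1) H]] ne Gc(2)
    by auto
  \<comment> \<open>After commuting the factors both quotients have the same denominator, so only
    the numerators are compared.\<close>
  have le: "?r \<le> indep_ratio G H (compl_graph G)"
    unfolding indep_ratio_def indep_num_strong_prod_commute[of H]
    using card_le_indep_num_strong_prod_compl[OF G] by (intro divide_right_mono) auto
  have le': "ereal (indep_ratio G H (compl_graph G)) \<le> rel_indep G H"
    using indep_ratio_le_rel_indep[OF Gc] .
  show lower: "rel_indep G H \<ge> ereal ?r"
    using order_trans[OF _ le'] le by simp
  assume vt: "vertex_transitive G"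
  have upper: "rel_indep G H \<le> ereal ?r"
    unfolding rel_indep_def
  proof (rule SUP_least)
    fix W :: "nat pair_pre_digraph"
    assume "W \<in> {W. pair_graph W \<and> pverts W \<noteq> {}}"
    then have W: "pair_graph W" "pverts W \<noteq> {}" by auto
    have "indep_num (strong_prod H W) > 0"
      using indep_num_pos[OF pair_graph_strong_prod[OF H W(1)]] ne W(2)
      by auto
    with indep_num_strong_prod_mult_le[OF G H W(1) vt] pos'
    show "ereal (indep_ratio G H W) \<le> ereal ?r"
      by (simp add: indep_ratio_def divide_simps flip: of_nat_mult)
  qed
  show "rel_indep G H = ereal ?r" using lower upper by (rule antisym[rotated])
  \<comment> \<open>The ratio at \<open>compl_graph G\<close> lies between \<open>?r\<close> and the
    supremum, which now coincide.\<close>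
  then show "rel_indep G H = ereal (indep_ratio G H (compl_graph G))"
    using le le' by (intro antisym) simp_all
next
  show "indep_num (strong_prod (compl_graph G) H) =
     Max {(\<Sum>i=1..k. card (T i)) | T :: nat \<Rightarrow> 'b set.
       (\<forall>i\<in>{1..k}. T i \<in> indep_sets H) \<and>
       (\<forall>i\<in>{1..k}. \<forall>j\<in>{1..k}. i \<noteq> j \<and> (v i, v j) \<notin> parcs G \<longrightarrow>
          disconnected_in H (T i) (T j))}"
    unfolding indep_num_def card_indep_sets_strong_prod_compl[OF assms] ..
qed

end
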